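(* Let $R$ be a commutative ring. Let $\ell\in\mathbb{N}$, $p\in\mathbb{Z}$ and $q\in\mathbb{Z}$. Let $g_{k,\,j}$ be an element of $R$ for all $k,j\in\mathbb{Z}$. Assume that $$g_{k,\,j}=0\quad\text{for all }k<0\text{ and }j\in\mathbb{Z}.$$ For any $m\in\mathbb{N}$ and any $\mu\in\mathbb{Z}^m$ and $\beta\in\mathbb{Z}^m$, define $$s_{\mu,\,\beta}:=\det\left(\left(g_{\mu_i+j-i,\ \beta_i+j-i}\right)_{i,j\in[m]}\right)\in R.$$ Let $\mu\in\mathbb{Z}^{\ell+1}$ be an $(\ell+1)$-tuple satisfying $\mu_{\ell+1}=0$. Let $\overline{\mu}$ be the $\ell$-tuple $(\mu_1,\mu_2,\ldots,\mu_\ell)\in\mathbb{Z}^\ell$. Let $\beta\in\mathbb{Z}^\ell$ be an $\ell$-tuple, and let $\beta'\in\mathbb{Z}^{\ell+1}$ be the $(\ell+1)$-tuple $(\beta_1,\beta_2,\ldots,\beta_\ell,\,q-p)$. Then $$g_{p,\,q}\cdot s_{\overline{\mu},\,\beta}=\sum_{\substack{\delta\in\mathbb{N}^{\ell+1};\\ |\delta|=p}}s_{\mu+\delta,\ \beta'+\delta}.$$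
   Context: $\mathbb{N}=\{0,1,2,\ldots\}$ and $[m]=\{1,2,\ldots,m\}$. For an $m$-tuple $\alpha$, $\alpha_i$ denotes its $i$-th entry, and for a tuple $\alpha\in\mathbb{Z}^m$ we set $|\alpha|:=\alpha_1+\cdots+\alpha_m$. Addition of tuples is entrywise. $(a_{i,j})_{i,j\in[m]}$ denotes the $m\times m$-matrix with $(i,j)$-th entry $a_{i,j}$. *)

theory Defs
  imports "Jordan_Normal_Form.Determinant"
begin

(* An m-tuple is a vector of dimension m, indexed from 0: the entry x $ i is the (i+1)-th entry
   of the tuple. The row and column indices occur only through the difference j - i, so the
   shift by one does not change the matrix. Only meant for dim_vec \<beta> = dim_vec \<mu>. *)
definition s_matrix ::
    "(int \<Rightarrow> int \<Rightarrow> 'a :: comm_ring_1) \<Rightarrow> int vec \<Rightarrow> int vec \<Rightarrow> 'a mat" where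
  "s_matrix g \<mu> \<beta> = mat (dim_vec \<mu>) (dim_vec \<mu>)
     (\<lambda>(i, j). g (\<mu> $ i + int j - int i) (\<beta> $ i + int j - int i))"

definition s_det ::
    "(int \<Rightarrow> int \<Rightarrow> 'a :: comm_ring_1) \<Rightarrow> int vec \<Rightarrow> int vec \<Rightarrow> 'a" where
  "s_det g \<mu> \<beta> = det (s_matrix g \<mu> \<beta>)"

definition entry_sum :: "nat vec \<Rightarrow> nat" where
  "entry_sum v = (\<Sum>i<dim_vec v. v $ i)"

(* The set of vectors over the naturals with prescribed entry sum is finite, so a sum over it is a genuine sum
   (HOL sums over infinite sets are 0). *)
lemma finite_nat_vec_entry_sum:
  fixes p :: int
  shows "finite {\<delta> \<in> carrier_vec n. int (entry_sum \<delta>) = p}"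
proof (rule finite_subset)
  show "{\<delta> \<in> carrier_vec n. int (entry_sum \<delta>) = p}
      \<subseteq> vec_of_list ` {xs. set xs \<subseteq> {..nat p} \<and> length xs = n}"
  proof
    fix v assume v: "v \<in> {\<delta> \<in> carrier_vec n. int (entry_sum \<delta>) = p}"
    have "v $ i \<le> nat p" if "i < n" for i
    proof -
      have "v $ i \<le> entry_sum v"
        unfolding entry_sum_def using v that by (intro member_le_sum) auto
      then show ?thesis using v by auto
    qed
    then have "list_of_vec v \<in> {xs. set xs \<subseteq> {..nat p} \<and> length xs = n}"
      using v by (auto simp: in_set_conv_nth list_of_vec_index)
    then show "v \<in> vec_of_list ` {xs. set xs \<subseteq> {..nat p} \<and> length xs = n}"
      by (metis image_eqI vec_list)
  qed
qed (simp add: finite_lists_length_eq)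

end

theory Submission
  imports Defs "HOL-Computational_Algebra.Formal_Power_Series"
begin

text \<open>Put \<open>f\<^sub>i(k) = g(\<mu>\<^sub>i - i + k, \<beta>'\<^sub>i - i + k)\<close>. The right-hand side is the coefficient of \<open>t\<^sup>p\<close> in
  the determinant of the matrix of power series \<open>F\<^sub>i\<^sub>j = (\<Sum>d. f\<^sub>i(j + d) t\<^sup>d)\<close>. Since
  \<open>F\<^sub>i\<^sub>j - t F\<^sub>i\<^sub>,\<^sub>j\<^sub>+\<^sub>1 = f\<^sub>i(j)\<close>, column operations make all columns but the last one constant. The
  last row then vanishes outside its last entry, and Laplace expansion along it gives the product
  on the left-hand side.\<close>

text \<open>The coefficient formula \<open>fps_prod_nth\<close> sums over the lists in
  \<open>natpermute\<close>, the theorem over vectors; \<open>list_of_vec\<close> and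
  \<open>vec_of_list\<close> match the two index sets.\<close>

lemma sum_natpermute_eq_sum_vec:
  "(\<Sum>xs \<in> natpermute p n. h (vec_of_list xs)) =
    (\<Sum>\<delta> \<in> {\<delta> \<in> carrier_vec n. entry_sum \<delta> = p}. h \<delta>)"
proof -
  have "entry_sum (vec_of_list xs) = sum_list xs" for xs
    by (simp add: entry_sum_def vec_of_list_index sum_list_sum_nth atLeast0LessThan)
  then have mem_iff:
    "vec_of_list xs \<in> {\<delta> \<in> carrier_vec n. entry_sum \<delta> = p} \<longleftrightarrow> xs \<in> natpermute p n" for xs
    by (auto simp: natpermute_def carrier_dim_vec simp del: carrier_vecD)
  have "list_of_vec \<delta> \<in> natpermute p n \<longleftrightarrow> \<delta> \<in> {\<delta> \<in> carrier_vec n. entry_sum \<delta> = p}" for \<delta>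
    by (simp only: mem_iff[symmetric] vec_list)
  with mem_iff show ?thesis
    by (intro sum.reindex_bij_witness[where i = list_of_vec and j = vec_of_list])
      (simp_all only: list_vec vec_list)
qed

lemma fps_nth_signof_mult:
  "fps_nth (signof \<pi> * a) p = signof \<pi> * fps_nth a p" for a :: "'a :: comm_ring_1 fps"
  by (cases \<pi> rule: sign_cases) simp_all

text \<open>In each Leibniz term, \<open>p\<close> is distributed over the factors, one from each
  row. Indexing the parts by rows makes the set of all \<open>\<delta>\<close> the same for every
  permutation, so the two sums can be swapped.\<close>

lemma fps_nth_det:
  fixes a :: "nat \<Rightarrow> nat \<Rightarrow> 'a :: comm_ring_1 fps"
  shows "fps_nth (det (mat (Suc l) (Suc l) (\<lambda>(i, j). a i j))) p =
    (\<Sum>\<delta> \<in> {\<delta> \<in> carrier_vec (Suc l). entry_sum \<delta> = p}.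
      det (mat (Suc l) (Suc l) (\<lambda>(i, j). fps_nth (a i j) (\<delta> $ i))))"
proof -
  let ?P = "{\<pi>. \<pi> permutes {0..<Suc l}}"
  let ?D = "{\<delta> \<in> carrier_vec (Suc l). entry_sum \<delta> = p}"
  \<comment> \<open>The product ranges over \<open>{0..l}\<close>, the shape that
    \<open>fps_prod_nth\<close> expects.\<close>
  have det_eq: "det (mat (Suc l) (Suc l) (\<lambda>(i, j). b i j)) =
      (\<Sum>\<pi> \<in> ?P. signof \<pi> * (\<Prod>i = 0..l. b i (\<pi> i)))" for b :: "nat \<Rightarrow> nat \<Rightarrow> 'b :: comm_ring_1"
  proof (subst det_def'[of _ "Suc l"], simp, intro sum.cong refl arg_cong2[where f = "(*)"] prod.cong)
    fix \<pi> i assume "\<pi> \<in> ?P" "i \<in> {0..l}"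
    then have "\<pi> i < Suc l"
      by (metis atLeastLessThan_iff atLeastLessThanSuc_atLeastAtMost mem_Collect_eq permutes_in_image)
    then show "mat (Suc l) (Suc l) (\<lambda>(i, j). b i j) $$ (i, \<pi> i) = b i (\<pi> i)"
      using \<open>i \<in> {0..l}\<close> by simp
  qed (simp add: atLeastLessThanSuc_atLeastAtMost)
  have "fps_nth (det (mat (Suc l) (Suc l) (\<lambda>(i, j). a i j))) p =
      (\<Sum>\<pi> \<in> ?P. signof \<pi> * fps_nth (\<Prod>i = 0..l. a i (\<pi> i)) p)"
    by (simp add: det_eq fps_sum_nth fps_nth_signof_mult)
  also have "\<dots> = (\<Sum>\<pi> \<in> ?P. signof \<pi> * (\<Sum>\<delta> \<in> ?D. \<Prod>i = 0..l. fps_nth (a i (\<pi> i)) (\<delta> $ i)))"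
    by (simp add: fps_prod_nth vec_of_list_index
        flip: sum_natpermute_eq_sum_vec)
  also have "\<dots> = (\<Sum>\<delta> \<in> ?D. det (mat (Suc l) (Suc l) (\<lambda>(i, j). fps_nth (a i j) (\<delta> $ i))))"
    unfolding det_eq sum_distrib_left by (rule sum.swap)
  finally show ?thesis .
qed

lemma comm_ring_hom_fps_const: "comm_ring_hom (fps_const :: 'a :: comm_ring_1 \<Rightarrow> 'a fps)"
  by unfold_locales simp_all

text \<open>Multiplying by \<open>fps_X\<close> realigns the two series, so all coefficients cancel
  except the constant one.\<close>

lemma Abs_fps_diff_fps_X_mult_shift: "Abs_fps (\<lambda>d. h (k + d)) - fps_X * Abs_fps (\<lambda>d. h (Suc k + d)) = fps_const (h k)"
  for h :: "nat \<Rightarrow> 'a :: comm_ring_1"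
  by (rule fps_ext) simp

lemma det_fps_shifts:
  fixes f :: "nat \<Rightarrow> nat \<Rightarrow> 'a :: comm_ring_1"
  assumes zero: "\<And>j. j < l \<Longrightarrow> f l j = 0"
  shows "det (mat (Suc l) (Suc l) (\<lambda>(i, j). Abs_fps (\<lambda>d. f i (j + d)))) =
    Abs_fps (\<lambda>d. f l (l + d)) * fps_const (det (mat l l (\<lambda>(i, j). f i j)))"
proof -
  let ?n = "Suc l"
  define F where "F = mat ?n ?n (\<lambda>(i, j). Abs_fps (\<lambda>d. f i (j + d)))"
  \<comment> \<open>Right multiplication by \<open>L\<close> subtracts \<open>fps_X\<close> times
    column \<open>j + 1\<close> from column \<open>j\<close>, for all \<open>j < l\<close> at
    once.\<close>
  define L :: "'a fps mat" where
    "L = mat ?n ?n (\<lambda>(i, j). if i = j then 1 else if i = Suc j then - fps_X else 0)"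
  define G where "G = mat ?n ?n (\<lambda>(i, j).
    if j = l then Abs_fps (\<lambda>d. f i (l + d)) else fps_const (f i j))"
  have carr: "F \<in> carrier_mat ?n ?n" "L \<in> carrier_mat ?n ?n" "G \<in> carrier_mat ?n ?n"
    by (simp_all add: F_def L_def G_def)
  have "F * L = G"
  proof (rule eq_matI)
    fix i j assume "i < dim_row G" "j < dim_col G"
    then have ij: "i < ?n" "j < ?n" by (simp_all add: G_def)
    let ?a = "\<lambda>k. Abs_fps (\<lambda>d. f i (k + d))"
    have "(F * L) $$ (i, j) =
        (\<Sum>k<?n. ?a k * (if k = j then 1 else if k = Suc j then - fps_X else 0))"
      using ij by (simp add: F_def L_def scalar_prod_def atLeast0LessThan del: sum.lessThan_Suc)
    also have "\<dots> = (\<Sum>k<?n. (if k = j then ?a j else 0) - (if k = Suc j then fps_X * ?a (Suc j) else 0))"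
      by (intro sum.cong) (simp_all add: mult.commute)
    \<comment> \<open>For \<open>j = l\<close> the index \<open>Suc j\<close> is out of range, so
      the last column stays unchanged.\<close>
    also have "\<dots> = ?a j - (if j = l then 0 else fps_X * ?a (Suc j))"
      using ij unfolding sum_subtractf by (simp add: sum.delta del: sum.lessThan_Suc)
    also have "\<dots> = G $$ (i, j)"
      using ij Abs_fps_diff_fps_X_mult_shift[of "f i" j] by (simp add: G_def)
    finally show "(F * L) $$ (i, j) = G $$ (i, j)" .
  qed (simp_all add: F_def L_def G_def)
  moreover have "det L = 1"
  proof -
    have "det L = prod_list (diag_mat L)"
      by (rule det_lower_triangular[of ?n]) (auto simp: L_def)
    then show ?thesis by (simp add: prod_list_diag_prod L_def)
  qed
  ultimately have "det F = det G"
    using det_mult[OF carr(1,2)] by simp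
  also have "\<dots> = (\<Sum>j<?n. G $$ (l, j) * cofactor G l j)"
    by (rule laplace_expansion_row[OF carr(3)]) simp
  \<comment> \<open>By \<open>zero\<close>, the last row of \<open>G\<close> vanishes in all columns
    \<open>j < l\<close>.\<close>
  also have "\<dots> = Abs_fps (\<lambda>d. f l (l + d)) * cofactor G l l"
    using zero by (simp add: G_def)
  \<comment> \<open>Deleting the last column removes the only column of \<open>G\<close> that need
    not be constant.\<close>
  also have "mat_delete G l l = map_mat fps_const (mat l l (\<lambda>(i, j). f i j))"
    by (rule eq_matI) (auto simp: mat_delete_def G_def)
  then have "cofactor G l l = fps_const (det (mat l l (\<lambda>(i, j). f i j)))"
    by (simp add: cofactor_def comm_ring_hom.hom_det[OF comm_ring_hom_fps_const])
  finally show ?thesis unfolding F_def .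
qed

theorem proposition3p7:
  fixes l :: nat and p q :: int
    and g :: "int \<Rightarrow> int \<Rightarrow> 'a :: comm_ring_1"
    and \<mu> \<beta> :: "int vec"
  assumes "\<And>k j. k < 0 \<Longrightarrow> g k j = 0"
    and "\<mu> \<in> carrier_vec (l + 1)"
    and "\<mu> $ l = 0"
    and "\<beta> \<in> carrier_vec l"
  shows "g p q * s_det g (vec_first \<mu> l) \<beta> =
    (\<Sum>\<delta> \<in> {\<delta> \<in> carrier_vec (l + 1). int (entry_sum \<delta>) = p}.
      s_det g (\<mu> + map_vec int \<delta>)
        ((\<beta> @\<^sub>v vec_of_list [q - p]) + map_vec int \<delta>))"
proof (cases "p < 0")
  case True
  then have no_tuples: "{\<delta> \<in> carrier_vec (l + 1). int (entry_sum \<delta>) = p} = {}" by auto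
  show ?thesis unfolding no_tuples by (simp add: assms(1) True)
next
  case False
  define \<beta>' where "\<beta>' = \<beta> @\<^sub>v vec_of_list [q - p]"
  \<comment> \<open>Adding \<open>\<delta>\<close> raises both indices of \<open>g\<close> in row
    \<open>i\<close> by \<open>\<delta> $ i\<close>, which turns \<open>f i j\<close> into
    \<open>f i (j + \<delta> $ i)\<close>.\<close>
  define f where "f i k = g (\<mu> $ i + int k - int i) (\<beta>' $ i + int k - int i)" for i k
  have dims: "dim_vec \<mu> = Suc l" "dim_vec \<beta> = l" "dim_vec \<beta>' = Suc l"
    using assms(2,4) by (auto simp: \<beta>'_def)
  have \<beta>'_last: "\<beta>' $ l = q - p"
    using dims by (simp add: \<beta>'_def)
  have first: "s_matrix g (vec_first \<mu> l) \<beta> = mat l l (\<lambda>(i, j). f i j)"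
    by (rule eq_matI) (auto simp: s_matrix_def f_def vec_first_def \<beta>'_def dims)
  have shifted: "s_matrix g (\<mu> + map_vec int \<delta>) (\<beta>' + map_vec int \<delta>) =
      mat (Suc l) (Suc l) (\<lambda>(i, j). fps_nth (Abs_fps (\<lambda>d. f i (j + d))) (\<delta> $ i))"
    if "\<delta> \<in> carrier_vec (Suc l)" for \<delta>
    using that by (intro eq_matI) (auto simp: s_matrix_def f_def dims algebra_simps)
  have tuples: "{\<delta> \<in> carrier_vec (l + 1). int (entry_sum \<delta>) = p} =
      {\<delta> \<in> carrier_vec (Suc l). entry_sum \<delta> = nat p}"
    using False by auto
  have "(\<Sum>\<delta> \<in> {\<delta> \<in> carrier_vec (l + 1). int (entry_sum \<delta>) = p}.
      s_det g (\<mu> + map_vec int \<delta>) (\<beta>' + map_vec int \<delta>)) =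
    (\<Sum>\<delta> \<in> {\<delta> \<in> carrier_vec (Suc l). entry_sum \<delta> = nat p}.
      det (mat (Suc l) (Suc l) (\<lambda>(i, j). fps_nth (Abs_fps (\<lambda>d. f i (j + d))) (\<delta> $ i))))"
    unfolding tuples s_det_def by (intro sum.cong refl arg_cong[where f = det] shifted) simp
  also have "\<dots> = fps_nth (det (mat (Suc l) (Suc l) (\<lambda>(i, j). Abs_fps (\<lambda>d. f i (j + d))))) (nat p)"
    by (rule fps_nth_det[symmetric])
  \<comment> \<open>Since \<open>\<mu> $ l = 0\<close>, the first index of \<open>g\<close> in
    \<open>f l j\<close> is \<open>j - l\<close>, which is negative for \<open>j < l\<close>; hence
    \<open>det_fps_shifts\<close> applies.\<close>
  also have "\<dots> = f l (l + nat p) * det (mat l l (\<lambda>(i, j). f i j))"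
    by (subst det_fps_shifts) (simp_all add: f_def assms(1,3))
  \<comment> \<open>The indices are \<open>0 + p\<close> and \<open>(q - p) + p\<close>, which
    accounts for the last entry \<open>q - p\<close> of \<open>\<beta>'\<close>.\<close>
  also have "f l (l + nat p) = g p q"
    using False by (simp add: f_def assms(3) \<beta>'_last)
  finally show ?thesis by (simp add: s_det_def first \<beta>'_def)
qed

end
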